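(* Let $X\subset\mathcal M^B$ be bounded, and let $\beta_D>0$ and $0<\Delta_D<\Delta_s$ be constants such that $\bigl\|\frac{d^2}{dt^2}R_x^B(tv)\bigr\|_{\mathcal E}\le\beta_D$ for all $x\in X$, all $v\in T_x\mathcal M^B$ with $\|v\|_{\mathcal E}=1$ and all $t\in[0,\Delta_D]$. Then the lifted objective functionals $J_x^B$, $x\in X$, are radially Lipschitz continuously differentiable on $X$ with $\Delta_{RL}=\Delta_D$ and some $\beta_{RL}>0$; that is, there exists $\beta_{RL}>0$ such that for every $x\in X$, every $\xi\in T_x\mathcal M^B$ with $\|\xi\|_{\mathcal E}=1$ and every $t\in[0,\Delta_D]$, $$\left|\left.\frac{d}{ds}J_x^B(s\xi)\right|_{s=t}-\left.\frac{d}{ds}J_x^B(s\xi)\right|_{s=0}\right|\le\beta_{RL}\,t .$$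
   Context: $\mathcal E,\mathcal Y$ are real Hilbert spaces, $\mathcal Y\neq\{0\}$. $\mathcal M\subset\mathcal E$ is a $C^2$ embedded submanifold; for $x\in\mathcal M$ the tangent space $T_x\mathcal M$ is identified with a closed linear subspace of $\mathcal E$ with the ambient norm. $B:\mathcal E\to\mathcal Y$ is a surjective bounded linear operator with adjoint $B^*$, $c\in\mathcal Y$, and $\mathcal M^B:=\{x\in\mathcal M: Bx=c\}$ is nonempty. For each $x\in\mathcal M$ a bounded linear projection $P_x:\mathcal E\to T_x\mathcal M$ onto $T_x\mathcal M$ is given (not necessarily orthogonal), and $L_x:=BP_xB^*:\mathcal Y\to\mathcal Y$. For each $x\in\mathcal M$ a $C^2$ map $R_x:T_x\mathcal M\to\mathcal M$ is given with $R_x(0)=x$, $DR_x(0)=\mathrm{Id}_{T_x\mathcal M}$. Standing assumptions: (A1) for every bounded $S\subset\mathcal M^B$ there is $C_S>0$ with $(L_x\delta,\delta)_{\mathcal Y}\ge C_S\|\delta\|_{\mathcal Y}^2$ for all $x\in S$, $\delta\in\mathcal Y$; (A2) the map $\mathcal M\to\mathcal L(\mathcal E,\mathcal E)$, $x\mapsto P_x$, is continuous and maps bounded sets to bounded sets; (A3) for every bounded $S\subset\mathcal M$ there are $\sigma,K_1,K_2>0$ such that $\|DR_x(u)\|\le K_1$ and $\|D^2R_x(u)\|\le K_2$ for all $x\in S$ and $u\in T_x\mathcal M$ with $\|u\|_{\mathcal E}\le\sigma$. Under (A1), $L_x$ is invertible and $\mathcal M^B$ is a $C^2$ Hilbert submanifold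 with $T_x\mathcal M^B=T_x\mathcal M\cap\ker B$. Constants for $X$: $K_P,K_L>0$ with $\|P_x\|\le K_P$, $\|L_x^{-1}\|\le K_L$ for $x\in X$; $\sigma,K_1,K_2>0$ as in (A3) for $S=X$; $$r:=\min\Bigl\{\tfrac{\sigma}{2K_P\|B\|},\tfrac{1}{4K_2K_LK_P^2\|B\|^3}\Bigr\},\qquad \Delta_s:=\min\Bigl\{\tfrac{\sigma}{2},\tfrac{1}{4K_2K_LK_P\|B\|^2},\tfrac{r}{2K_1K_L\|B\|}\Bigr\}.$$ With $V_x^B(\rho):=\{v\in T_x\mathcal M^B:\|v\|_{\mathcal E}<\rho\}$: for $x\in X$, $v\in V_x^B(\Delta_s)$, $\delta_x(v)$ is the unique $\delta\in\mathcal Y$ with $\|\delta\|_{\mathcal Y}\le r$ and $BR_x(v-P_xB^*\delta)=c$; it is known that $\delta_x$ is $C^2$ with $\delta_x(0)=0$. The $C^2$ local retraction is $R_x^B(v):=R_x(v-P_xB^*\delta_x(v))\in\mathcal M^B$ for $v\in V_x^B(\Delta_s)$; it satisfies $R_x^B(0)=x$, $DR_x^B(0)=\mathrm{Id}$. (Constants $\beta_D,\Delta_D$ as in the claim are known to exist.) Objective: $J:\mathcal E\to\mathbb R$ is $C^2$, bounded from below and coercive; its gradient $\operatorname{grad}J:\mathcal E\to\mathcal E$ and Hessian $\operatorname{Hess}J:\mathcal E\to\mathcal L(\mathcal E;\mathcal E)$ map bounded sets to bounded sets. The lifted objective is $J_x^B(\xi):=J(R_x^B(\xi))$ for $\xi\in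 V_x^B(\Delta_s)$. *)

theory Defs
  imports "HOL-Analysis.Analysis"
begin

(* S is meant to be open, or a closed subspace of 'a.  In the latter case Df u and D2f u are
   determined by f only on S (resp. S x S); off S they are an arbitrary bounded linear extension,
   so norms of derivatives must be taken over arguments in S. *)
definition has_C2_derivs_on ::
  "('a::real_normed_vector \<Rightarrow> 'b::real_normed_vector) \<Rightarrow> ('a \<Rightarrow> 'a \<Rightarrow>\<^sub>L 'b) \<Rightarrow>
   ('a \<Rightarrow> 'a \<Rightarrow>\<^sub>L 'a \<Rightarrow>\<^sub>L 'b) \<Rightarrow> 'a set \<Rightarrow> bool" where
  "has_C2_derivs_on f Df D2f S \<longleftrightarrow>
     (\<forall>u\<in>S. (f has_derivative blinfun_apply (Df u)) (at u within S)) \<and>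
     (\<forall>u\<in>S. (Df has_derivative blinfun_apply (D2f u)) (at u within S)) \<and>
     continuous_on S D2f"

definition C2_on :: "'a::real_normed_vector set \<Rightarrow> ('a \<Rightarrow> 'b::real_normed_vector) \<Rightarrow> bool" where
  "C2_on S f \<longleftrightarrow> (\<exists>Df D2f. has_C2_derivs_on f Df D2f S)"

(* Submanifold charts.  Closed subspaces of a Hilbert space are complemented, so no splitting
   condition on F is needed. *)
definition C2_submanifold :: "'e::{real_inner, banach} set \<Rightarrow> bool" where
  "C2_submanifold M \<longleftrightarrow>
     (\<forall>x\<in>M. \<exists>U V F. \<exists>\<phi> \<psi> :: 'e \<Rightarrow> 'e. open U \<and> x \<in> U \<and> open V \<and> subspace F \<and> closed F \<and>
        homeomorphism U V \<phi> \<psi> \<and> C2_on U \<phi> \<and> C2_on V \<psi> \<and> \<phi> ` (U \<inter> M) = V \<inter> F)"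

definition tangent_space :: "'e::real_normed_vector set \<Rightarrow> 'e \<Rightarrow> 'e set" where
  "tangent_space M x =
     {v. \<exists>\<gamma>::real \<Rightarrow> 'e. \<exists>\<epsilon>>0. \<gamma> ` {-\<epsilon><..<\<epsilon>} \<subseteq> M \<and> \<gamma> C1_differentiable_on {-\<epsilon><..<\<epsilon>} \<and>
          \<gamma> 0 = x \<and> (\<gamma> has_vector_derivative v) (at 0)}"

definition constrained_set :: "'e set \<Rightarrow> ('e::real_normed_vector \<Rightarrow>\<^sub>L 'y::real_normed_vector) \<Rightarrow> 'y \<Rightarrow> 'e set" where
  "constrained_set M B c = {x \<in> M. B x = c}"

definition is_projection_onto :: "('e::real_normed_vector \<Rightarrow>\<^sub>L 'e) \<Rightarrow> 'e set \<Rightarrow> bool" where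
  "is_projection_onto Q T \<longleftrightarrow> range (blinfun_apply Q) = T \<and> (\<forall>h. Q (Q h) = Q h)"

definition L_op ::
  "('e::{real_inner, banach} \<Rightarrow>\<^sub>L 'y::{real_inner, banach}) \<Rightarrow> ('e \<Rightarrow> 'e \<Rightarrow>\<^sub>L 'e) \<Rightarrow> 'e \<Rightarrow> 'y \<Rightarrow> 'y" where
  "L_op B P x \<delta> = B (P x (adjoint (blinfun_apply B) \<delta>))"

(* R x is only used on the tangent space at x.  DR x, D2R x are its derivatives along that
   subspace; since M is embedded, a map into M is C2 iff it is C2 as a map into the ambient space. *)
definition C2_retraction ::
  "'e::{real_inner, banach} set \<Rightarrow> ('e \<Rightarrow> 'e \<Rightarrow> 'e) \<Rightarrow> ('e \<Rightarrow> 'e \<Rightarrow> 'e \<Rightarrow>\<^sub>L 'e) \<Rightarrow>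
   ('e \<Rightarrow> 'e \<Rightarrow> 'e \<Rightarrow>\<^sub>L 'e \<Rightarrow>\<^sub>L 'e) \<Rightarrow> bool" where
  "C2_retraction M R DR D2R \<longleftrightarrow>
     (\<forall>x\<in>M. R x ` tangent_space M x \<subseteq> M \<and>
            has_C2_derivs_on (R x) (DR x) (D2R x) (tangent_space M x) \<and>
            R x 0 = x \<and> (\<forall>h\<in>tangent_space M x. DR x 0 h = h))"

(* The last two lines are the bounds K1, K2 for the operator norms of the first and second
   derivatives of R x as (bi)linear maps on the tangent space. *)
definition retraction_bounds ::
  "'e::{real_inner, banach} set \<Rightarrow> ('e \<Rightarrow> 'e \<Rightarrow> 'e \<Rightarrow>\<^sub>L 'e) \<Rightarrow> ('e \<Rightarrow> 'e \<Rightarrow> 'e \<Rightarrow>\<^sub>L 'e \<Rightarrow>\<^sub>L 'e) \<Rightarrow>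
   'e set \<Rightarrow> real \<Rightarrow> real \<Rightarrow> real \<Rightarrow> bool" where
  "retraction_bounds M DR D2R S \<sigma> K1 K2 \<longleftrightarrow>
     \<sigma> > 0 \<and> K1 > 0 \<and> K2 > 0 \<and>
     (\<forall>x\<in>S. \<forall>u\<in>tangent_space M x. norm u \<le> \<sigma> \<longrightarrow>
        (\<forall>h\<in>tangent_space M x. norm (DR x u h) \<le> K1 * norm h) \<and>
        (\<forall>h\<in>tangent_space M x. \<forall>k\<in>tangent_space M x. norm (D2R x u h k) \<le> K2 * norm h * norm k))"

definition delta_map ::
  "('e::{real_inner, banach} \<Rightarrow>\<^sub>L 'y::{real_inner, banach}) \<Rightarrow> 'y \<Rightarrow> ('e \<Rightarrow> 'e \<Rightarrow>\<^sub>L 'e) \<Rightarrow>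
   ('e \<Rightarrow> 'e \<Rightarrow> 'e) \<Rightarrow> real \<Rightarrow> 'e \<Rightarrow> 'e \<Rightarrow> 'y" where
  "delta_map B c P R r x v =
     (THE \<delta>. norm \<delta> \<le> r \<and> B (R x (v - P x (adjoint (blinfun_apply B) \<delta>))) = c)"

(* Meaningful for v in the tangent space of the constrained set at x with norm v < Delta_s. *)
definition retr_B ::
  "('e::{real_inner, banach} \<Rightarrow>\<^sub>L 'y::{real_inner, banach}) \<Rightarrow> 'y \<Rightarrow> ('e \<Rightarrow> 'e \<Rightarrow>\<^sub>L 'e) \<Rightarrow>
   ('e \<Rightarrow> 'e \<Rightarrow> 'e) \<Rightarrow> real \<Rightarrow> 'e \<Rightarrow> 'e \<Rightarrow> 'e" where
  "retr_B B c P R r x v =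
     R x (v - P x (adjoint (blinfun_apply B) (delta_map B c P R r x v)))"

definition lifted_objective ::
  "('e::{real_inner, banach} \<Rightarrow> real) \<Rightarrow> ('e \<Rightarrow>\<^sub>L 'y::{real_inner, banach}) \<Rightarrow> 'y \<Rightarrow>
   ('e \<Rightarrow> 'e \<Rightarrow>\<^sub>L 'e) \<Rightarrow> ('e \<Rightarrow> 'e \<Rightarrow> 'e) \<Rightarrow> real \<Rightarrow> 'e \<Rightarrow> 'e \<Rightarrow> real" where
  "lifted_objective J B c P R r x \<xi> = J (retr_B B c P R r x \<xi>)"

(* deriv is total in HOL, hence the explicit differentiability. *)
definition radially_Lipschitz_C1 ::
  "'e::real_normed_vector set \<Rightarrow> ('e \<Rightarrow> 'e set) \<Rightarrow> ('e \<Rightarrow> 'e \<Rightarrow> real) \<Rightarrow> real \<Rightarrow> real \<Rightarrow> bool" where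
  "radially_Lipschitz_C1 X T Jl \<Delta> \<beta> \<longleftrightarrow>
     (\<forall>x\<in>X. \<forall>\<xi>\<in>T x. norm \<xi> = 1 \<longrightarrow>
        (\<forall>t\<in>{0..\<Delta>}. (\<lambda>s::real. Jl x (s *\<^sub>R \<xi>)) differentiable (at t) \<and>
           \<bar>deriv (\<lambda>s::real. Jl x (s *\<^sub>R \<xi>)) t - deriv (\<lambda>s::real. Jl x (s *\<^sub>R \<xi>)) 0\<bar> \<le> \<beta> * t))"

end

theory Submission
  imports Defs
begin

text \<open>
  Fix \<open>x\<close> in \<open>X\<close> and a unit tangent vector \<open>v\<close>, and let \<open>\<kappa> t\<close> be the constrained retraction of
  \<open>t v\<close>. If \<open>\<kappa>\<close> is twice differentiable, the theorem is the chain rule: the second derivative of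
  \<open>J \<circ> \<kappa>\<close> is \<open>Hess J (\<kappa>' , \<kappa>') + grad J \<bullet> \<kappa>''\<close>. Since \<open>\<kappa>' 0 = v\<close> has norm one and \<open>\<kappa>''\<close> is bounded
  by \<open>\<beta>D\<close>, the velocity is at most \<open>1 + \<beta>D \<Delta>D\<close>, so all the curves stay in one ball around the origin.
  There the gradient and the Hessian of \<open>J\<close> are bounded, which bounds \<open>(J \<circ> \<kappa>)''\<close> uniformly in \<open>x\<close>
  and \<open>v\<close>, and the mean value inequality gives the Lipschitz estimate
  (\<open>radial_objective_Lipschitz\<close>).

  The hypothesis on \<open>\<kappa>''\<close> is stated with the total operator for vector derivatives, so it says
  something only once \<open>\<kappa>\<close> is known to be twice differentiable on a neighbourhood of \<open>[0, \<Delta>D]\<close>. This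
  regularity is most of the work. Write \<open>L = B P\<^sub>x B\<^sup>*\<close>, \<open>E = L\<^sup>-\<^sup>1 B\<close> and \<open>A = P\<^sub>x B\<^sup>*\<close>, so that
  \<open>E \<circ> A = id\<close>. The correction \<open>\<delta> t\<close> solves \<open>E (R\<^sub>x (t v - A \<delta>) - x) = 0\<close>. As \<open>R\<^sub>x\<close> is near the
  identity on the tangent space, with a defect controlled by \<open>K2\<close>, the map
  \<open>\<delta> \<mapsto> \<delta> + E (R\<^sub>x (t v - A \<delta>) - x)\<close> contracts the ball of radius \<open>r\<close> with factor one half; this
  is what the constants \<open>r\<close> and \<open>\<Delta>s\<close> are made for (\<open>correction_exists_unique\<close>). The same estimate makes
  \<open>\<delta>\<close> Lipschitz in \<open>t\<close> and keeps the linearized operator \<open>E \<circ> DR\<^sub>x \<circ> A\<close> within one half of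
  the identity, hence invertible. Differentiability of \<open>\<delta>\<close> follows, and its derivative solves a linear
  equation with differentiable coefficients, hence is differentiable as well
  (\<open>corrected_curve_twice_differentiable\<close>).

  The existence of \<open>B\<^sup>*\<close> rests on the Riesz representation theorem and that of \<open>L\<^sup>-\<^sup>1\<close> on the Lax-Milgram
  theorem.
\<close>

section \<open>Riesz representation, adjoints and coercive operators\<close>

text \<open>
  The representing vector is the minimizer of \<open>q z = \<parallel>z\<parallel>\<^sup>2 / 2 - f z\<close>. It exists because the
  parallelogram law makes every minimizing sequence Cauchy, and the first-order condition at the
  minimizer is \<open>f h = h \<bullet> z\<close>.
\<close>

lemma riesz_representation:
  fixes f :: "'a::{real_inner, banach} \<Rightarrow> real"
  assumes f: "bounded_linear f"
  obtains z where "\<And>h. f h = h \<bullet> z"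
proof -
  interpret f: bounded_linear f by (rule f)
  define q where "q z = (norm z)\<^sup>2 / 2 - f z" for z
  obtain K where K: "\<And>z. norm (f z) \<le> norm z * K" using f.bounded by blast
  have q_below: "q z \<ge> - (K\<^sup>2 / 2)" for z
  proof -
    have "f z \<le> norm z * K" using K[of z] by simp
    moreover have "0 \<le> (norm z - K)\<^sup>2" by simp
    ultimately show ?thesis unfolding q_def by (simp add: power2_diff)
  qed
  define I where "I = Inf (range q)"
  have bdd: "bdd_below (range q)" using q_below by (intro bdd_belowI[of _ "- (K\<^sup>2 / 2)"]) auto
  have I_le: "I \<le> q z" for z unfolding I_def by (rule cInf_lower[OF _ bdd]) simp
  have "\<exists>z. q z < I + 1 / real (Suc n)" for n
  proof -
    have "I < I + 1 / real (Suc n)" by simp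
    then show ?thesis unfolding I_def by (subst (asm) cInf_less_iff) (auto simp: bdd)
  qed
  then obtain s where s: "\<And>n. q (s n) < I + 1 / real (Suc n)" by metis
  have par: "(norm (z - w))\<^sup>2 \<le> 4 * (q z - I + (q w - I))" for z w
  proof -
    have "(norm (z - w))\<^sup>2 = 4 * (q z + q w - 2 * q ((1/2) *\<^sub>R (z + w)))"
      unfolding q_def
      by (simp add: f.add f.scaleR power2_norm_eq_inner inner_simps inner_commute field_simps)
    then show ?thesis using I_le[of "(1/2) *\<^sub>R (z + w)"] by simp
  qed
  have "Cauchy s"
  proof (rule CauchyI)
    fix e :: real assume e: "e > 0"
    then obtain N where N: "8 / e\<^sup>2 < real N" using reals_Archimedean2 by blast
    have "norm (s m - s n) < e" if mn: "m \<ge> N" "n \<ge> N" for m n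
    proof -
      have small: "1 / real (Suc k) < e\<^sup>2 / 8" if "k \<ge> N" for k
      proof -
        have "8 / e\<^sup>2 < real (Suc k)" using N that by linarith
        then show ?thesis using e by (simp add: field_simps)
      qed
      have "(norm (s m - s n))\<^sup>2 < e\<^sup>2"
        using par[of "s m" "s n"] s[of m] s[of n] small[OF mn(1)] small[OF mn(2)] by argo
      then show ?thesis using e by (meson less_imp_le power_less_imp_less_base)
    qed
    then show "\<exists>M. \<forall>m\<ge>M. \<forall>n\<ge>M. norm (s m - s n) < e" by blast
  qed
  then obtain z where z: "s \<longlonglongrightarrow> z" using Cauchy_convergent_iff convergent_def by blast
  have "(\<lambda>n. q (s n)) \<longlonglongrightarrow> q z"
    unfolding q_def by (intro tendsto_intros z f.tendsto) auto
  moreover have "(\<lambda>n. I + 1 / real (Suc n)) \<longlonglongrightarrow> I + 0"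
    by (intro tendsto_intros LIMSEQ_Suc[OF lim_1_over_n])
  ultimately have "q z \<le> I + 0"
    by (rule LIMSEQ_le) (meson s less_imp_le)
  then have min: "q z \<le> q w" for w using I_le[of w] by simp
  have "f h = h \<bullet> z" for h
  proof (cases "h = 0")
    case True then show ?thesis by (simp add: f.zero)
  next
    case False
    \<comment> \<open>the minimizer of the quadratic polynomial \<open>t \<mapsto> q (z + t h)\<close>\<close>
    define t where "t = (f h - h \<bullet> z) / (h \<bullet> h)"
    have hh: "h \<bullet> h > 0" using False by simp
    have "q (z + t *\<^sub>R h) = q z + t * (h \<bullet> z - f h) + t\<^sup>2 * (h \<bullet> h) / 2"
      unfolding q_def
      by (simp add: f.add f.scaleR power2_norm_eq_inner inner_simps inner_commute power2_eq_square[of t]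
          field_simps)
    then have "0 \<le> t * (h \<bullet> z - f h) + t\<^sup>2 * (h \<bullet> h) / 2" using min[of "z + t *\<^sub>R h"] by simp
    also have "\<dots> = - ((f h - h \<bullet> z)\<^sup>2 / (2 * (h \<bullet> h)))"
      unfolding t_def using hh by (simp add: power2_eq_square field_simps)
    finally have "(f h - h \<bullet> z)\<^sup>2 / (2 * (h \<bullet> h)) \<le> 0" by simp
    then have "(f h - h \<bullet> z)\<^sup>2 \<le> 0" using hh by (simp add: divide_le_0_iff)
    then show ?thesis by simp
  qed
  then show ?thesis by (rule that)
qed

text \<open>
  The adjoint is a choice of a function with this property, which is meaningful only if such a
  function exists; on a Hilbert space Riesz representation supplies it.
\<close>

lemma adjoint_inner:
  fixes B :: "'a::{real_inner, banach} \<Rightarrow>\<^sub>L 'b::real_inner"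
  shows "B h \<bullet> y = h \<bullet> adjoint (blinfun_apply B) y"
proof -
  have "\<exists>z. \<forall>h. B h \<bullet> y = h \<bullet> z" for y
  proof -
    have "bounded_linear (\<lambda>h. B h \<bullet> y)"
      by (intro bounded_linear_intros)
    then show ?thesis using riesz_representation by metis
  qed
  then have "\<exists>g. \<forall>h y. B h \<bullet> y = h \<bullet> g y" by metis
  then show ?thesis unfolding adjoint_def by (rule someI2_ex) simp
qed

lemma bounded_linear_adjoint:
  fixes B :: "'a::{real_inner, banach} \<Rightarrow>\<^sub>L 'b::real_inner"
  shows "bounded_linear (adjoint (blinfun_apply B))"
    and "norm (adjoint (blinfun_apply B) y) \<le> norm B * norm y"
proof -
  let ?A = "adjoint (blinfun_apply B)"
  have bound: "norm (?A y) \<le> norm B * norm y" for y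
  proof (cases "?A y = 0")
    case False
    have "norm (?A y) * norm (?A y) = B (?A y) \<bullet> y"
      by (simp add: adjoint_inner dot_square_norm power2_eq_square)
    also have "\<dots> \<le> norm (B (?A y)) * norm y" by (rule norm_cauchy_schwarz)
    also have "\<dots> \<le> (norm B * norm (?A y)) * norm y"
      by (intro mult_right_mono norm_blinfun) auto
    finally have "norm (?A y) * norm (?A y) \<le> norm (?A y) * (norm B * norm y)"
      by (simp add: ac_simps)
    then show ?thesis using False by (simp add: mult_le_cancel_left)
  qed simp
  show "bounded_linear ?A"
  proof (rule bounded_linear_intro)
    show "?A (x + y) = ?A x + ?A y" for x y
      by (rule vector_eq_ldot[THEN iffD1])
        (simp add: adjoint_inner[symmetric] inner_right_distrib)
    show "?A (s *\<^sub>R x) = s *\<^sub>R ?A x" for s x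
      by (rule vector_eq_ldot[THEN iffD1]) (simp add: adjoint_inner[symmetric])
    show "norm (?A x) \<le> norm x * norm B" for x
      using bound[of x] by (simp add: mult.commute)
  qed
  show "norm (?A y) \<le> norm B * norm y" by (rule bound)
qed

text \<open>
  Solutions of \<open>N h = y\<close> are the fixed points of the contraction \<open>h \<mapsto> h - N h + y\<close>.
\<close>

lemma surj_of_near_identity:
  fixes N :: "'a::banach \<Rightarrow> 'a"
  assumes N: "linear N" and q: "0 \<le> q" "q < 1"
    and near: "\<And>h. norm (N h - h) \<le> q * norm h"
  shows "surj N"
proof -
  interpret N: linear N by (rule N)
  have "\<exists>h. N h = y" for y
  proof -
    have "\<exists>!h. h - N h + y = h"
    proof (rule banach_fix_type[OF q], intro allI)
      fix h k
      have "dist (h - N h + y) (k - N k + y) = norm (N (h - k) - (h - k))"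
        unfolding dist_norm by (subst norm_minus_commute) (simp add: N.diff algebra_simps)
      then show "dist (h - N h + y) (k - N k + y) \<le> q * dist h k"
        using near[of "h - k"] by (simp add: dist_norm)
    qed
    then show ?thesis by (metis add_diff_cancel_right' diff_add_cancel add_right_cancel diff_eq_eq add.commute)
  qed
  then show ?thesis by (metis surjI)
qed

text \<open>
  For \<open>\<parallel>L h\<parallel> \<le> K \<parallel>h\<parallel>\<close> and \<open>s = C / K\<^sup>2\<close>, expanding the square gives
  \<open>\<parallel>s L h - h\<parallel>\<^sup>2 \<le> (1 - (C / K)\<^sup>2) \<parallel>h\<parallel>\<^sup>2\<close>. So a multiple of \<open>L\<close> is near the identity and surjective;
  coercivity also bounds \<open>L\<close> from below, which gives injectivity and the bound for the inverse.
\<close>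

lemma lax_milgram:
  fixes L :: "'a::{real_inner, banach} \<Rightarrow> 'a"
  assumes L: "bounded_linear L" and C: "C > 0"
    and coercive: "\<And>h. L h \<bullet> h \<ge> C * (norm h)\<^sup>2"
  shows "bij L" and "bounded_linear (inv L)"
proof -
  interpret L: bounded_linear L by (rule L)
  have lower: "C * norm h \<le> norm (L h)" for h
  proof (cases "h = 0")
    case False
    have "norm h * (C * norm h) \<le> L h \<bullet> h"
      using coercive[of h] by (simp add: power2_eq_square ac_simps)
    also have "\<dots> \<le> norm (L h) * norm h" by (rule norm_cauchy_schwarz)
    finally show ?thesis using False by (simp add: mult.commute)
  qed (simp add: L.zero)
  obtain K0 where K0: "\<And>h. norm (L h) \<le> norm h * K0" using L.bounded by blast
  \<comment> \<open>a bound above \<open>C\<close>, so that \<open>1 - (C / K)\<^sup>2\<close> is nonnegative also on the trivial space\<close>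
  define K where "K = max K0 C"
  have K: "norm (L h) \<le> K * norm h" for h
    using K0[of h] mult_left_mono[of K0 K "norm h"] by (simp add: K_def mult.commute)
  have K_pos: "K > 0" "C \<le> K" using C by (auto simp: K_def)
  define s where "s = C / K\<^sup>2"
  have s: "s > 0" using C K_pos by (simp add: s_def)
  define q where "q = sqrt (1 - (C / K)\<^sup>2)"
  have CK: "0 < C / K" "C / K \<le> 1" using C K_pos by auto
  have q: "0 \<le> q" "q < 1" "q\<^sup>2 = 1 - (C / K)\<^sup>2"
    using CK by (auto simp: q_def power_le_one)
  have "norm (s *\<^sub>R L h - h) \<le> q * norm h" for h
  proof (rule power2_le_imp_le)
    have "(norm (s *\<^sub>R L h - h))\<^sup>2 = (norm h)\<^sup>2 - 2 * s * (L h \<bullet> h) + s\<^sup>2 * (norm (L h))\<^sup>2"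
      by (simp add: power2_norm_eq_inner inner_simps inner_commute power2_eq_square[of s] algebra_simps)
    also have "\<dots> \<le> (norm h)\<^sup>2 - 2 * s * (C * (norm h)\<^sup>2) + s\<^sup>2 * (K * norm h)\<^sup>2"
      using coercive[of h] s K[of h]
      by (intro add_mono diff_mono mult_left_mono power_mono) auto
    also have "\<dots> = (q * norm h)\<^sup>2"
      unfolding power_mult_distrib q(3) s_def using K_pos
      by (simp add: field_simps power2_eq_square)
    finally show "(norm (s *\<^sub>R L h - h))\<^sup>2 \<le> (q * norm h)\<^sup>2" .
  qed (use q in simp)
  then have surj: "surj (\<lambda>h. s *\<^sub>R L h)"
    using surj_of_near_identity[of "\<lambda>h. s *\<^sub>R L h" q] q
    by (simp add: L.linear linear_compose_scale_right)
  have "\<exists>h. L h = y" for y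
  proof -
    obtain h where "s *\<^sub>R L h = y" using surj by (metis surjD)
    then have "L (s *\<^sub>R h) = y" by (simp add: L.scaleR)
    then show ?thesis by blast
  qed
  moreover have "inj L"
  proof (rule injI)
    fix x y assume "L x = L y"
    then have "L (x - y) = 0" by (simp add: L.diff)
    then have "norm (x - y) \<le> 0" using lower[of "x - y"] C by (simp add: mult_le_0_iff)
    then show "x = y" by simp
  qed
  ultimately show bij: "bij L" by (metis bij_def surjI)
  have LI: "L (inv L y) = y" for y using bij by (simp add: bij_is_surj surj_f_inv_f)
  show "bounded_linear (inv L)"
  proof (rule bounded_linear_intro)
    show "inv L (x + y) = inv L x + inv L y" for x y
      by (rule inv_f_eq[OF \<open>inj L\<close>]) (simp add: L.add LI)
    show "inv L (a *\<^sub>R x) = a *\<^sub>R inv L x" for a x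
      by (rule inv_f_eq[OF \<open>inj L\<close>]) (simp add: L.scaleR LI)
    show "norm (inv L x) \<le> norm x * (1 / C)" for x
      using lower[of "inv L x"] C by (simp add: LI field_simps)
  qed
qed

section \<open>Calculus along segments and for linear systems\<close>

text \<open>
  A mean value inequality that bounds the derivative only in the direction of the segment. An
  operator norm bound would be too strong an assumption for derivatives within a subspace, whose values
  off the subspace are arbitrary.
\<close>

lemma norm_diff_le_along_segment:
  fixes f :: "'a::real_normed_vector \<Rightarrow> 'b::real_normed_vector"
  assumes S: "convex S" "y \<in> S" "z \<in> S"
    and der: "\<And>u. u \<in> S \<Longrightarrow> (f has_derivative f' u) (at u within S)"
    and bound: "\<And>u. u \<in> S \<Longrightarrow> norm (f' u (y - z)) \<le> C"
  shows "norm (f y - f z) \<le> C"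
proof -
  let ?p = "\<lambda>s::real. z + s *\<^sub>R (y - z)"
  have p: "?p ` {0..1} \<subseteq> S"
  proof clarify
    fix s :: real assume "s \<in> {0..1}"
    then have "(1 - s) *\<^sub>R z + s *\<^sub>R y \<in> S" using S by (intro convexD) auto
    then show "?p s \<in> S" by (simp add: algebra_simps)
  qed
  have "norm (f (?p 1) - f (?p 0)) \<le> C * norm (1 - 0 :: real)"
  proof (rule differentiable_bound[where S = "{0..1}" and f' = "\<lambda>s h. f' (?p s) (h *\<^sub>R (y - z))"])
    fix s :: real assume s: "s \<in> {0..1}"
    then have ps: "?p s \<in> S" using p by blast
    have "(?p has_derivative (\<lambda>h. h *\<^sub>R (y - z))) (at s within {0..1})"
      by (auto intro!: derivative_eq_intros)
    then show "((\<lambda>s. f (?p s)) has_derivative (\<lambda>h. f' (?p s) (h *\<^sub>R (y - z)))) (at s within {0..1})"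
      by (rule has_derivative_in_compose[OF _ has_derivative_subset[OF der[OF ps] p]])
    interpret D: bounded_linear "f' (?p s)"
      using der[OF ps] by (rule has_derivative_bounded_linear)
    show "onorm (\<lambda>h. f' (?p s) (h *\<^sub>R (y - z))) \<le> C"
    proof (rule onorm_le)
      fix h :: real
      show "norm (f' (?p s) (h *\<^sub>R (y - z))) \<le> C * norm h"
        using mult_right_mono[OF bound[OF ps], of "\<bar>h\<bar>"] by (simp add: D.scaleR mult.commute)
    qed
  qed auto
  then show ?thesis by simp
qed

text \<open>
  With \<open>e t = b t - N t (w t0) - (t - t0) N t k\<close> one has
  \<open>N t (w t - w t0 - (t - t0) k) = e t\<close>. The choice of \<open>k\<close> makes the derivative of \<open>e\<close> at \<open>t0\<close>
  vanish, and the uniform lower bound on \<open>N\<close> transfers this to \<open>w\<close>.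
\<close>

lemma linear_system_solution_has_vector_derivative:
  fixes N :: "real \<Rightarrow> 'a::real_normed_vector \<Rightarrow>\<^sub>L 'b::real_normed_vector"
  assumes N: "(N has_vector_derivative N') (at t0)"
    and b: "(b has_vector_derivative b') (at t0)"
    and eq: "\<forall>\<^sub>F t in at t0. N t (w t) = b t" and eq0: "N t0 (w t0) = b t0"
    and m: "m > 0" and lower: "\<forall>\<^sub>F t in at t0. \<forall>h. m * norm h \<le> norm (N t h)"
    and k: "N t0 k = b' - N' (w t0)"
  shows "(w has_vector_derivative k) (at t0)"
proof -
  define e where "e t = b t - N t (w t0) - (t - t0) *\<^sub>R N t k" for t
  have Nh: "((\<lambda>t. N t h) has_vector_derivative N' h) (at t0)" for h
    by (rule bounded_linear.has_vector_derivative[OF blinfun.bounded_linear_left N])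
  have "(e has_vector_derivative b' - N' (w t0) - ((t0 - t0) *\<^sub>R N' k + 1 *\<^sub>R N t0 k)) (at t0)"
    unfolding e_def
    by (intro has_vector_derivative_diff b Nh has_vector_derivative_scaleR)
      (auto intro!: derivative_eq_intros)
  then have "(e has_derivative (\<lambda>h. 0)) (at t0)"
    by (simp add: k has_vector_derivative_def)
  moreover have "e t0 = 0" by (simp add: e_def eq0)
  ultimately have "((\<lambda>t. norm (e t) / norm (t - t0)) \<longlongrightarrow> 0) (at t0)"
    by (simp add: has_derivative_iff_norm)
  then have lim: "((\<lambda>t. (norm (e t) / norm (t - t0)) / m) \<longlongrightarrow> 0) (at t0)"
    using m tendsto_divide[OF _ tendsto_const, of _ 0 "at t0" m] by fastforce
  have "((\<lambda>t. norm (w t - w t0 - (t - t0) *\<^sub>R k) / norm (t - t0)) \<longlongrightarrow> 0) (at t0)"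
  proof (rule tendsto_sandwich[OF _ _ tendsto_const lim])
    show "\<forall>\<^sub>F t in at t0. norm (w t - w t0 - (t - t0) *\<^sub>R k) / norm (t - t0)
        \<le> (norm (e t) / norm (t - t0)) / m"
      using eq lower
    proof eventually_elim
      case (elim t)
      have "N t (w t - w t0 - (t - t0) *\<^sub>R k) = e t"
        by (simp add: e_def blinfun.bilinear_simps elim(1))
      then have "m * norm (w t - w t0 - (t - t0) *\<^sub>R k) \<le> norm (e t)"
        using elim(2) by metis
      then have "norm (w t - w t0 - (t - t0) *\<^sub>R k) \<le> norm (e t) / m"
        using m by (simp add: field_simps)
      then have "norm (w t - w t0 - (t - t0) *\<^sub>R k) / norm (t - t0) \<le> norm (e t) / m / norm (t - t0)"
        by (rule divide_right_mono) simp
      then show ?case by (simp add: field_simps)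
    qed
  qed auto
  then show ?thesis
    unfolding has_vector_derivative_def has_derivative_iff_norm
    by (simp add: bounded_linear_scaleR_left)
qed

section \<open>Constraint correction along a tangent ray\<close>

text \<open>
  The setting for one point and one direction. \<open>T\<close> is the tangent space, \<open>\<rho>\<close> the retraction, and
  \<open>E\<close> measures the constraint violation, normalized so that \<open>E\<close> is a left inverse of the correction
  operator \<open>A\<close>. All derivatives of \<open>\<rho>\<close> are taken within \<open>T\<close> and bounded only on \<open>T\<close>.

  Arguments of \<open>\<rho>\<close> have norm at most \<open>\<Delta> + \<kappa>A r\<close>. The three inequalities at the end keep them in the
  ball where the derivative bounds hold, make \<open>\<delta> \<mapsto> E ((\<rho> - id) (t v - A \<delta>))\<close> a contraction with
  factor one half, and keep the violation of the uncorrected step small enough for the contraction to map the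
  ball of radius \<open>r\<close> to itself.
\<close>

locale tangential_correction =
  fixes T :: "'e::real_normed_vector set"
    and \<rho> :: "'e \<Rightarrow> 'e"
    and D\<rho> :: "'e \<Rightarrow> 'e \<Rightarrow>\<^sub>L 'e"
    and D2\<rho> :: "'e \<Rightarrow> 'e \<Rightarrow>\<^sub>L 'e \<Rightarrow>\<^sub>L 'e"
    and E :: "'e \<Rightarrow>\<^sub>L 'y::banach"
    and A :: "'y \<Rightarrow>\<^sub>L 'e"
    and v :: 'e
    and \<kappa>E \<kappa>A K1 K2 \<sigma> r \<Delta> :: real
  assumes T: "subspace T"
    and D\<rho>: "\<And>u. u \<in> T \<Longrightarrow> (\<rho> has_derivative D\<rho> u) (at u within T)"
    and D2\<rho>: "\<And>u. u \<in> T \<Longrightarrow> (D\<rho> has_derivative D2\<rho> u) (at u within T)"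
    and D\<rho>_0: "\<And>h. h \<in> T \<Longrightarrow> D\<rho> 0 h = h"
    and D\<rho>_bound: "\<And>u h. \<lbrakk>u \<in> T; norm u \<le> \<sigma>; h \<in> T\<rbrakk> \<Longrightarrow> norm (D\<rho> u h) \<le> K1 * norm h"
    and D2\<rho>_bound: "\<And>u h k. \<lbrakk>u \<in> T; norm u \<le> \<sigma>; h \<in> T; k \<in> T\<rbrakk>
        \<Longrightarrow> norm (D2\<rho> u h k) \<le> K2 * norm h * norm k"
    and A_T: "\<And>y. A y \<in> T"
    and E_A: "\<And>y. E (A y) = y"
    and v: "v \<in> T" "norm v = 1" "E v = 0"
    and norms: "norm E \<le> \<kappa>E" "norm A \<le> \<kappa>A"
    and pos: "\<kappa>E > 0" "\<kappa>A > 0" "K1 > 0" "K2 > 0" "r > 0" "\<Delta> > 0"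
    and step_in_range: "\<Delta> + \<kappa>A * r \<le> \<sigma>"
    and contraction_constant: "\<kappa>E * \<kappa>A * K2 * (\<Delta> + \<kappa>A * r) \<le> 1 / 2"
    and small_defect: "\<kappa>E * K1 * \<Delta> \<le> r / 2"
begin

definition correction :: "real \<Rightarrow> 'y" where
  "correction t = (THE \<delta>. norm \<delta> \<le> r \<and> E (\<rho> (t *\<^sub>R v - A \<delta>) - \<rho> 0) = 0)"

definition corrected :: "real \<Rightarrow> 'e" where
  "corrected t = t *\<^sub>R v - A (correction t)"

abbreviation radius :: real where "radius \<equiv> \<Delta> + \<kappa>A * r"

lemma step_in_T: "t *\<^sub>R v - A \<delta> \<in> T"
  using T v(1) A_T by (simp add: subspace_diff subspace_scale)

lemma norm_E_le: "norm (E h) \<le> \<kappa>E * norm h"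
  by (rule order_trans[OF norm_blinfun]) (simp add: norms mult_right_mono)

lemma norm_A_le: "norm (A y) \<le> \<kappa>A * norm y"
  by (rule order_trans[OF norm_blinfun]) (simp add: norms mult_right_mono)

lemma norm_step_le:
  assumes "\<bar>t\<bar> < \<Delta>" "norm \<delta> \<le> r"
  shows "norm (t *\<^sub>R v - A \<delta>) \<le> radius"
proof -
  have "norm (t *\<^sub>R v - A \<delta>) \<le> \<bar>t\<bar> + norm (A \<delta>)"
    using norm_triangle_ineq4[of "t *\<^sub>R v" "A \<delta>"] v(2) by simp
  also have "norm (A \<delta>) \<le> \<kappa>A * r"
    using norm_A_le[of \<delta>] assms(2) pos(2) by (meson less_imp_le mult_left_mono order_trans)
  finally show ?thesis using assms(1) by simp
qed

lemma convex_T_cball: "convex (T \<inter> cball 0 s)"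
  by (intro convex_Int subspace_imp_convex T convex_cball)

lemma D\<rho>_near_id:
  assumes u: "u \<in> T" "norm u \<le> \<sigma>" and k: "k \<in> T"
  shows "norm (D\<rho> u k - k) \<le> K2 * norm u * norm k"
proof -
  have 0: "0 \<in> T" using T by (rule subspace_0)
  have "0 \<le> \<sigma>" using u(2) norm_ge_zero order_trans by blast
  have "norm (D\<rho> u k - D\<rho> 0 k) \<le> K2 * norm (u - 0) * norm k"
  proof (rule norm_diff_le_along_segment[where f = "\<lambda>u. D\<rho> u k" and S = "T \<inter> cball 0 \<sigma>"
        and f' = "\<lambda>w h. D2\<rho> w h k"])
    fix w assume w: "w \<in> T \<inter> cball 0 \<sigma>"
    have "(D\<rho> has_derivative D2\<rho> w) (at w within T \<inter> cball 0 \<sigma>)"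
      using w by (intro has_derivative_subset[OF D2\<rho>]) auto
    then show "((\<lambda>u. D\<rho> u k) has_derivative (\<lambda>h. D2\<rho> w h k)) (at w within T \<inter> cball 0 \<sigma>)"
      by (rule bounded_linear.has_derivative[OF blinfun.bounded_linear_left])
    show "norm (D2\<rho> w (u - 0) k) \<le> K2 * norm (u - 0) * norm k"
      using w u k by (intro D2\<rho>_bound) auto
  qed (use u 0 \<open>0 \<le> \<sigma>\<close> convex_T_cball in auto)
  then show ?thesis using k by (simp add: D\<rho>_0)
qed

lemma \<rho>_near_id:
  assumes "u \<in> T" "norm u \<le> radius" "w \<in> T" "norm w \<le> radius"
  shows "norm (\<rho> u - \<rho> w - (u - w)) \<le> K2 * radius * norm (u - w)"
proof -
  have "norm ((\<rho> u - u) - (\<rho> w - w)) \<le> K2 * radius * norm (u - w)"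
  proof (rule norm_diff_le_along_segment[where f = "\<lambda>u. \<rho> u - u" and S = "T \<inter> cball 0 radius"
        and f' = "\<lambda>z h. D\<rho> z h - h"])
    fix z assume z: "z \<in> T \<inter> cball 0 radius"
    show "((\<lambda>u. \<rho> u - u) has_derivative (\<lambda>h. D\<rho> z h - h)) (at z within T \<inter> cball 0 radius)"
      using z by (intro has_derivative_diff has_derivative_ident has_derivative_subset[OF D\<rho>]) auto
    have "norm (D\<rho> z (u - w) - (u - w)) \<le> K2 * norm z * norm (u - w)"
      using z assms T step_in_range by (intro D\<rho>_near_id) (auto simp: subspace_diff)
    also have "\<dots> \<le> K2 * radius * norm (u - w)"
      using z pos by (intro mult_right_mono mult_left_mono) auto
    finally show "norm (D\<rho> z (u - w) - (u - w)) \<le> K2 * radius * norm (u - w)" .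
  qed (use assms convex_T_cball in auto)
  then show ?thesis by (simp add: algebra_simps)
qed

text \<open>
  The estimate behind existence, uniqueness and Lipschitz continuity of the correction: \<open>E\<close> sees the
  nonlinear part \<open>\<rho> - id\<close> only through a small Lipschitz constant.
\<close>

lemma E_\<rho>_near_id:
  assumes "u \<in> T" "norm u \<le> radius" "w \<in> T" "norm w \<le> radius"
  shows "norm (E (\<rho> u - \<rho> w - (u - w))) \<le> \<kappa>E * K2 * radius * norm (u - w)"
proof -
  have "norm (E (\<rho> u - \<rho> w - (u - w))) \<le> \<kappa>E * (K2 * radius * norm (u - w))"
    using norm_E_le \<rho>_near_id[OF assms] pos(1) by (meson less_imp_le mult_left_mono order_trans)
  then show ?thesis by (simp add: ac_simps)
qed

text \<open>
  Because \<open>E \<circ> A = id\<close>, differences of \<open>\<Phi> \<delta> = \<delta> + E (\<rho> (t v - A \<delta>) - \<rho> 0)\<close> involve only the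
  nonlinear part of \<open>\<rho>\<close>, so Banach's fixed point theorem applies to \<open>\<Phi>\<close> on the ball of radius \<open>r\<close>.
\<close>

lemma correction_exists_unique:
  assumes t: "\<bar>t\<bar> < \<Delta>"
  shows "\<exists>!\<delta>. norm \<delta> \<le> r \<and> E (\<rho> (t *\<^sub>R v - A \<delta>) - \<rho> 0) = 0"
proof -
  define \<Phi> where "\<Phi> \<delta> = \<delta> + E (\<rho> (t *\<^sub>R v - A \<delta>) - \<rho> 0)" for \<delta>
  have contraction: "norm (\<Phi> \<delta> - \<Phi> \<epsilon>) \<le> 1 / 2 * norm (\<delta> - \<epsilon>)"
    if "norm \<delta> \<le> r" "norm \<epsilon> \<le> r" for \<delta> \<epsilon>
  proof -
    let ?u = "t *\<^sub>R v - A \<delta>" and ?w = "t *\<^sub>R v - A \<epsilon>"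
    have uw: "?u - ?w = - A (\<delta> - \<epsilon>)" by (simp add: blinfun.diff_right)
    have "\<Phi> \<delta> - \<Phi> \<epsilon> = E (\<rho> ?u - \<rho> ?w - (?u - ?w))"
      unfolding uw \<Phi>_def by (simp add: blinfun.bilinear_simps E_A)
    moreover have "norm (E (\<rho> ?u - \<rho> ?w - (?u - ?w))) \<le> \<kappa>E * K2 * radius * norm (?u - ?w)"
      by (intro E_\<rho>_near_id step_in_T norm_step_le t that)
    ultimately have "norm (\<Phi> \<delta> - \<Phi> \<epsilon>) \<le> \<kappa>E * K2 * radius * norm (?u - ?w)" by (simp only:)
    also have "\<dots> \<le> \<kappa>E * K2 * radius * (\<kappa>A * norm (\<delta> - \<epsilon>))"
      unfolding uw using norm_A_le[of "\<delta> - \<epsilon>"] pos by (intro mult_left_mono) auto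
    also have "\<dots> = (\<kappa>E * \<kappa>A * K2 * radius) * norm (\<delta> - \<epsilon>)" by (simp add: ac_simps)
    also have "\<dots> \<le> 1 / 2 * norm (\<delta> - \<epsilon>)"
      by (intro mult_right_mono contraction_constant) simp
    finally show ?thesis .
  qed
  have zero: "norm (\<Phi> 0) \<le> r / 2"
  proof -
    have tv: "t *\<^sub>R v \<in> T" "norm (t *\<^sub>R v) \<le> radius"
      using step_in_T[of t 0] norm_step_le[OF t, of 0] pos by auto
    have "0 \<le> radius" using pos by simp
    have "norm (\<rho> (t *\<^sub>R v) - \<rho> 0) \<le> K1 * norm (t *\<^sub>R v - 0)"
    proof (rule norm_diff_le_along_segment[where f = \<rho> and S = "T \<inter> cball 0 radius" and f' = "\<lambda>z h. D\<rho> z h"])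
      fix z assume z: "z \<in> T \<inter> cball 0 radius"
      show "(\<rho> has_derivative D\<rho> z) (at z within T \<inter> cball 0 radius)"
        using z by (intro has_derivative_subset[OF D\<rho>]) auto
      show "norm (D\<rho> z (t *\<^sub>R v - 0)) \<le> K1 * norm (t *\<^sub>R v - 0)"
        using z tv step_in_range by (intro D\<rho>_bound) auto
    qed (use tv convex_T_cball subspace_0[OF T] \<open>0 \<le> radius\<close> in auto)
    then have "norm (\<rho> (t *\<^sub>R v) - \<rho> 0) \<le> K1 * \<bar>t\<bar>" using v(2) by simp
    also have "\<dots> \<le> K1 * \<Delta>" using t pos(3) by simp
    finally have "norm (\<Phi> 0) \<le> \<kappa>E * (K1 * \<Delta>)"
      using norm_E_le[of "\<rho> (t *\<^sub>R v) - \<rho> 0"] pos(1) unfolding \<Phi>_def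
      by (simp add: order_trans[OF _ mult_left_mono])
    then show ?thesis using small_defect by (simp add: ac_simps)
  qed
  have "\<exists>!\<delta>. \<delta> \<in> cball 0 r \<and> \<Phi> \<delta> = \<delta>"
  proof (rule Banach_fix[where c = "1 / 2"])
    show "complete (cball (0::'y) r)" by (simp add: complete_eq_closed)
    show "cball (0::'y) r \<noteq> {}" using pos(5) by simp
    show "\<Phi> ` cball 0 r \<subseteq> cball 0 r"
    proof clarify
      fix \<delta> :: 'y assume "\<delta> \<in> cball 0 r"
      then have "norm \<delta> \<le> r" by simp
      then have "norm (\<Phi> \<delta> - \<Phi> 0) \<le> r / 2" using contraction[of \<delta> 0] pos(5) by simp
      then have "norm (\<Phi> \<delta>) \<le> r"
        using zero norm_triangle_sub[of "\<Phi> \<delta>" "\<Phi> 0"] by simp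
      then show "\<Phi> \<delta> \<in> cball 0 r" by simp
    qed
    show "dist (\<Phi> \<delta>) (\<Phi> \<epsilon>) \<le> 1 / 2 * dist \<delta> \<epsilon>"
      if "\<delta> \<in> cball 0 r" "\<epsilon> \<in> cball 0 r" for \<delta> \<epsilon>
      using contraction[of \<delta> \<epsilon>] that by (simp add: dist_norm)
  qed auto
  then show ?thesis by (simp add: \<Phi>_def)
qed

lemma correction:
  assumes "\<bar>t\<bar> < \<Delta>"
  shows "norm (correction t) \<le> r" and "E (\<rho> (corrected t) - \<rho> 0) = 0"
  using theI'[OF correction_exists_unique[OF assms]]
  unfolding correction_def corrected_def by auto

lemma correction_0: "correction 0 = 0"
  unfolding correction_def
  by (rule the1_equality[OF correction_exists_unique]) (use pos in auto)

lemma corrected_in_T: "corrected t \<in> T"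
  unfolding corrected_def by (rule step_in_T)

lemma norm_corrected_le: "\<bar>t\<bar> < \<Delta> \<Longrightarrow> norm (corrected t) \<le> radius"
  unfolding corrected_def by (intro norm_step_le correction)

text \<open>
  Since \<open>E v = 0\<close> and \<open>E \<circ> A = id\<close>, applying \<open>E\<close> to a difference of two corrected steps yields minus
  the difference of the corrections. Both steps satisfy the constraint, so this difference is again
  controlled by the nonlinear part of \<open>\<rho>\<close>. The resulting bound contains the difference of the corrections
  itself with a factor at most one half, which is absorbed on the left-hand side.
\<close>

lemma corrected_lipschitz:
  obtains C where "C > 0"
    and "\<And>t s. \<bar>t\<bar> < \<Delta> \<Longrightarrow> \<bar>s\<bar> < \<Delta> \<Longrightarrow> norm (corrected t - corrected s) \<le> C * \<bar>t - s\<bar>"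
proof -
  define C1 where "C1 = 2 * (\<kappa>E * K2 * radius)"
  have "C1 > 0" using pos unfolding C1_def by (simp add: add_pos_pos)
  have bound: "norm (corrected t - corrected s) \<le> (1 + \<kappa>A * C1) * \<bar>t - s\<bar>"
    if ts: "\<bar>t\<bar> < \<Delta>" "\<bar>s\<bar> < \<Delta>" for t s
  proof -
    let ?d = "correction t - correction s"
    have diff: "corrected t - corrected s = (t - s) *\<^sub>R v - A ?d"
      by (simp add: corrected_def blinfun.diff_right scaleR_diff_left)
    have norm_diff: "norm (corrected t - corrected s) \<le> \<bar>t - s\<bar> + \<kappa>A * norm ?d"
      unfolding diff using norm_triangle_ineq4[of "(t - s) *\<^sub>R v" "A ?d"] norm_A_le[of ?d] v(2) by simp
    have "E (\<rho> (corrected t) - \<rho> (corrected s)) = 0"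
      using correction(2)[OF ts(1)] correction(2)[OF ts(2)] by (simp add: blinfun.diff_right)
    then have "?d = E (\<rho> (corrected t) - \<rho> (corrected s) - (corrected t - corrected s))"
      by (subst blinfun.diff_right) (simp add: diff blinfun.bilinear_simps E_A v(3))
    then have "norm ?d \<le> \<kappa>E * K2 * radius * norm (corrected t - corrected s)"
      using E_\<rho>_near_id[OF corrected_in_T norm_corrected_le corrected_in_T norm_corrected_le] ts
      by simp
    also have "\<dots> \<le> \<kappa>E * K2 * radius * (\<bar>t - s\<bar> + \<kappa>A * norm ?d)"
      using norm_diff pos by (intro mult_left_mono) auto
    also have "\<dots> = \<kappa>E * K2 * radius * \<bar>t - s\<bar> + (\<kappa>E * \<kappa>A * K2 * radius) * norm ?d"
      by (simp add: algebra_simps)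
    also have "\<dots> \<le> \<kappa>E * K2 * radius * \<bar>t - s\<bar> + 1 / 2 * norm ?d"
      by (intro add_left_mono mult_right_mono contraction_constant) simp
    finally have "norm ?d \<le> C1 * \<bar>t - s\<bar>" by (simp add: C1_def)
    then have "\<kappa>A * norm ?d \<le> \<kappa>A * (C1 * \<bar>t - s\<bar>)" using pos(2) by simp
    then show ?thesis using norm_diff by (simp add: algebra_simps)
  qed
  show ?thesis
    by (rule that[OF _ bound]) (use pos \<open>C1 > 0\<close> in \<open>simp add: add_pos_pos\<close>)
qed

text \<open>
  Up to sign the partial derivative of \<open>E (\<rho> (t v - A \<delta>) - \<rho> 0)\<close> in \<open>\<delta>\<close> at the correction.
\<close>

definition linearization :: "real \<Rightarrow> 'y \<Rightarrow>\<^sub>L 'y" where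
  "linearization t = E o\<^sub>L D\<rho> (corrected t) o\<^sub>L A"

text \<open>
  The derivative of the correction, as implicit differentiation predicts it. The choice operator
  stands for the inverse of the linearization.
\<close>

definition correction' :: "real \<Rightarrow> 'y" where
  "correction' t = (SOME k. linearization t k = E (D\<rho> (corrected t) v))"

lemma linearization_near_id:
  assumes t: "\<bar>t\<bar> < \<Delta>"
  shows "norm (linearization t h - h) \<le> 1 / 2 * norm h"
proof -
  have u: "corrected t \<in> T" "norm (corrected t) \<le> radius" "norm (corrected t) \<le> \<sigma>"
    using corrected_in_T norm_corrected_le[OF t] step_in_range by auto
  have "linearization t h - h = E (D\<rho> (corrected t) (A h) - A h)"
    by (simp add: linearization_def blinfun.diff_right E_A)
  then have "norm (linearization t h - h) \<le> \<kappa>E * norm (D\<rho> (corrected t) (A h) - A h)"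
    by (simp add: norm_E_le)
  also have "\<dots> \<le> \<kappa>E * (K2 * norm (corrected t) * norm (A h))"
    using u pos by (intro mult_left_mono D\<rho>_near_id A_T) auto
  also have "\<dots> \<le> \<kappa>E * (K2 * radius * (\<kappa>A * norm h))"
    using u pos norm_A_le[of h] by (intro mult_left_mono mult_mono) auto
  also have "\<dots> = (\<kappa>E * \<kappa>A * K2 * radius) * norm h" by (simp add: ac_simps)
  also have "\<dots> \<le> 1 / 2 * norm h"
    by (intro mult_right_mono contraction_constant) simp
  finally show ?thesis .
qed

lemma linearization_lower:
  assumes "\<bar>t\<bar> < \<Delta>"
  shows "1 / 2 * norm h \<le> norm (linearization t h)"
proof -
  have "norm h \<le> norm (linearization t h) + norm (linearization t h - h)"
    by (metis norm_triangle_sub norm_minus_commute)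
  then show ?thesis using linearization_near_id[OF assms, of h] by argo
qed

lemma linearization_surj:
  assumes "\<bar>t\<bar> < \<Delta>"
  obtains k where "linearization t k = y"
proof -
  have "surj (linearization t)"
    by (rule surj_of_near_identity[where q = "1 / 2"])
      (use linearization_near_id[OF assms] in
        \<open>auto intro: bounded_linear.linear blinfun.bounded_linear_right\<close>)
  then show ?thesis using that by (metis surjD)
qed

lemma correction'_eq:
  assumes "\<bar>t\<bar> < \<Delta>"
  shows "linearization t (correction' t) = E (D\<rho> (corrected t) v)"
  unfolding correction'_def using linearization_surj[OF assms] by (metis (mono_tags) someI_ex)

lemma eventually_in_interval:
  assumes "\<bar>t\<bar> < \<Delta>"
  shows "\<forall>\<^sub>F s in at t. \<bar>s\<bar> < \<Delta>"
proof -
  have "\<forall>\<^sub>F s in at t. s \<in> {-\<Delta><..<\<Delta>}"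
    using assms by (intro eventually_at_in_open') auto
  then show ?thesis by eventually_elim auto
qed

text \<open>
  Between two times the constraint does not change, so \<open>E\<close> maps the first-order remainder of \<open>\<rho>\<close> to
  minus its linear part, which is the linearization applied to the error of the predicted
  derivative. The remainder is small relative to the time difference because corrected steps are
  Lipschitz, and the linearization is bounded below.
\<close>

lemma correction_has_derivative:
  assumes t: "\<bar>t\<bar> < \<Delta>"
  shows "(correction has_vector_derivative correction' t) (at t)"
  unfolding has_vector_derivative_def has_derivative_within_alt2
proof (intro conjI allI impI bounded_linear_scaleR_left)
  fix \<epsilon> :: real assume \<epsilon>: "\<epsilon> > 0"
  obtain C where C: "C > 0" and lip:
    "\<And>t s. \<bar>t\<bar> < \<Delta> \<Longrightarrow> \<bar>s\<bar> < \<Delta> \<Longrightarrow> norm (corrected t - corrected s) \<le> C * \<bar>t - s\<bar>"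
    using corrected_lipschitz by blast
  let ?u = "corrected t"
  \<comment> \<open>factor 2 from the lower bound of the linearization, \<open>\<kappa>E\<close> from \<open>E\<close>, \<open>C\<close> from the Lipschitz bound\<close>
  define e where "e = \<epsilon> / (2 * \<kappa>E * C)"
  have e: "e > 0" using \<epsilon> C pos(1) by (simp add: e_def)
  obtain d where d: "d > 0" and small: "\<And>y. \<lbrakk>y \<in> T; norm (y - ?u) < d\<rbrakk> \<Longrightarrow>
      norm (\<rho> y - \<rho> ?u - D\<rho> ?u (y - ?u)) \<le> e * norm (y - ?u)"
    using D\<rho>[OF corrected_in_T[of t]] e unfolding has_derivative_within_alt by meson
  have "\<forall>\<^sub>F s in at t. dist s t < d / C"
    using d C by (auto simp: eventually_at intro!: exI[of _ "d / C"])
  with eventually_in_interval[OF t]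
  show "\<forall>\<^sub>F s in at t. norm (correction s - correction t - (s - t) *\<^sub>R correction' t) \<le> \<epsilon> * norm (s - t)"
  proof eventually_elim
    case (elim s)
    let ?w = "corrected s"
    let ?R = "\<rho> ?w - \<rho> ?u - D\<rho> ?u (?w - ?u)"
    let ?z = "correction s - correction t - (s - t) *\<^sub>R correction' t"
    have near: "norm (?w - ?u) \<le> C * \<bar>s - t\<bar>" using lip elim(1) t by blast
    also have "\<dots> < d" using elim(2) C by (simp add: dist_real_def field_simps)
    finally have R: "norm ?R \<le> e * norm (?w - ?u)" by (intro small corrected_in_T)
    have diff: "?w - ?u = (s - t) *\<^sub>R v - A (correction s - correction t)"
      by (simp add: corrected_def blinfun.diff_right scaleR_diff_left)
    have "E (\<rho> ?w - \<rho> ?u) = 0"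
      using correction(2)[OF elim(1)] correction(2)[OF t] by (simp add: blinfun.diff_right)
    then have "E ?R = - E (D\<rho> ?u (?w - ?u))" by (simp add: blinfun.diff_right)
    also have "\<dots> = linearization t (correction s - correction t) - (s - t) *\<^sub>R E (D\<rho> ?u v)"
      unfolding diff by (simp add: linearization_def blinfun.bilinear_simps)
    also have "\<dots> = linearization t ?z"
      by (simp add: blinfun.bilinear_simps correction'_eq[OF t])
    finally have "norm ?z \<le> 2 * norm (E ?R)" using linearization_lower[OF t, of ?z] by simp
    also have "\<dots> \<le> 2 * (\<kappa>E * (e * (C * \<bar>s - t\<bar>)))"
    proof -
      have "norm (E ?R) \<le> \<kappa>E * norm ?R" by (rule norm_E_le)
      also have "\<dots> \<le> \<kappa>E * (e * (C * \<bar>s - t\<bar>))"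
        using R near pos(1) e by (intro mult_left_mono) (auto intro: order_trans mult_left_mono)
      finally show ?thesis by simp
    qed
    also have "\<dots> = \<epsilon> * norm (s - t)" using pos(1) C by (simp add: e_def)
    finally show ?case .
  qed
qed

lemma corrected_has_derivative:
  assumes "\<bar>t\<bar> < \<Delta>"
  shows "(corrected has_vector_derivative v - A (correction' t)) (at t)"
proof -
  have "((\<lambda>t. t *\<^sub>R v - A (correction t)) has_vector_derivative (t *\<^sub>R 0 + 1 *\<^sub>R v) - A (correction' t)) (at t)"
    by (intro has_vector_derivative_diff has_vector_derivative_scaleR has_vector_derivative_const
        bounded_linear.has_vector_derivative[OF blinfun.bounded_linear_right]
        correction_has_derivative assms DERIV_ident)
  then show ?thesis by (simp add: corrected_def[abs_def])
qed

lemma has_vector_derivative_along_corrected: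
  assumes t: "\<bar>t\<bar> < \<Delta>"
    and f: "(f has_derivative blinfun_apply f') (at (corrected t) within T)"
  shows "((\<lambda>s. f (corrected s)) has_vector_derivative f' (v - A (correction' t))) (at t)"
proof -
  have "((\<lambda>s. f (corrected s)) has_derivative (\<lambda>h. f' (h *\<^sub>R (v - A (correction' t))))) (at t)"
    using corrected_has_derivative[OF t] unfolding has_vector_derivative_def
    by (rule has_derivative_in_compose)
      (use corrected_in_T in \<open>auto intro: has_derivative_subset[OF f]\<close>)
  then show ?thesis by (simp add: has_vector_derivative_def blinfun.scaleR_right)
qed

text \<open>
  The derivative of the correction solves a linear system whose coefficients contain \<open>D\<rho>\<close> along the
  corrected steps; these are differentiable because \<open>\<rho>\<close> has a second derivative.
\<close>

lemma correction'_has_derivative: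
  assumes t: "\<bar>t\<bar> < \<Delta>"
  obtains k where "(correction' has_vector_derivative k) (at t)"
proof -
  let ?D = "\<lambda>s. D\<rho> (corrected s)" and ?D' = "D2\<rho> (corrected t) (v - A (correction' t))"
  have D: "(?D has_vector_derivative ?D') (at t)"
    by (rule has_vector_derivative_along_corrected[OF t D2\<rho>[OF corrected_in_T]])
  have N: "(linearization has_vector_derivative E o\<^sub>L ?D' o\<^sub>L A) (at t)"
  proof -
    have "bounded_linear (\<lambda>X. E o\<^sub>L X o\<^sub>L A)"
      by (intro bounded_linear_intros)
    from bounded_linear.has_vector_derivative[OF this D] show ?thesis
      by (simp add: linearization_def[abs_def])
  qed
  have b: "((\<lambda>s. E (?D s v)) has_vector_derivative E (?D' v)) (at t)"
    by (intro bounded_linear.has_vector_derivative[OF blinfun.bounded_linear_right]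
        bounded_linear.has_vector_derivative[OF blinfun.bounded_linear_left] D)
  obtain k where k: "linearization t k = E (?D' v) - (E o\<^sub>L ?D' o\<^sub>L A) (correction' t)"
    using linearization_surj[OF t] by blast
  have eq: "\<forall>\<^sub>F s in at t. linearization s (correction' s) = E (?D s v)"
    using eventually_in_interval[OF t] by eventually_elim (rule correction'_eq)
  have lower: "\<forall>\<^sub>F s in at t. \<forall>h. 1 / 2 * norm h \<le> norm (linearization s h)"
    using eventually_in_interval[OF t] by eventually_elim (use linearization_lower in blast)
  have "(correction' has_vector_derivative k) (at t)"
    by (rule linear_system_solution_has_vector_derivative[where w = correction' and m = "1 / 2",
          OF N b eq correction'_eq[OF t] _ lower k]) simp
  then show ?thesis by (rule that)
qed

lemma correction'_0: "correction' 0 = 0"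
proof -
  have "corrected 0 = 0" by (simp add: corrected_def correction_0)
  then have "E (D\<rho> (corrected 0) v) = 0" using v by (simp add: D\<rho>_0)
  then have "linearization 0 (correction' 0) = 0"
    using correction'_eq[of 0] pos by simp
  then show ?thesis using linearization_lower[of 0 "correction' 0"] pos by simp
qed

theorem corrected_curve_twice_differentiable:
  obtains c1 c2 where
    "\<And>t. \<bar>t\<bar> < \<Delta> \<Longrightarrow> ((\<lambda>t. \<rho> (corrected t)) has_vector_derivative c1 t) (at t)"
    "\<And>t. \<bar>t\<bar> < \<Delta> \<Longrightarrow> (c1 has_vector_derivative c2 t) (at t)"
    "c1 0 = v"
proof -
  define c1 where "c1 t = D\<rho> (corrected t) (v - A (correction' t))" for t
  have c1: "((\<lambda>t. \<rho> (corrected t)) has_vector_derivative c1 t) (at t)" if "\<bar>t\<bar> < \<Delta>" for t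
    unfolding c1_def
    by (rule has_vector_derivative_along_corrected[OF that D\<rho>[OF corrected_in_T]])
  have "\<exists>k. (c1 has_vector_derivative k) (at t)" if t: "\<bar>t\<bar> < \<Delta>" for t
  proof -
    obtain k where k: "(correction' has_vector_derivative k) (at t)"
      using correction'_has_derivative[OF t] .
    have D: "((\<lambda>s. D\<rho> (corrected s)) has_vector_derivative
        D2\<rho> (corrected t) (v - A (correction' t))) (at t)"
      by (rule has_vector_derivative_along_corrected[OF t D2\<rho>[OF corrected_in_T]])
    have "((\<lambda>s. v - A (correction' s)) has_vector_derivative 0 - A k) (at t)"
      by (intro has_vector_derivative_diff has_vector_derivative_const
          bounded_linear.has_vector_derivative[OF blinfun.bounded_linear_right] k)
    from bounded_bilinear.has_vector_derivative[OF bounded_bilinear_blinfun_apply D this]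
    show ?thesis unfolding c1_def by blast
  qed
  then obtain c2 where "\<And>t. \<bar>t\<bar> < \<Delta> \<Longrightarrow> (c1 has_vector_derivative c2 t) (at t)" by metis
  moreover have "c1 0 = v"
    using v(1) by (simp add: c1_def corrected_def correction_0 correction'_0 D\<rho>_0)
  ultimately show ?thesis using c1 that by blast
qed

end

section \<open>The constrained retraction\<close>

text \<open>
  A curve in the constrained set is a curve in \<open>M\<close> along which \<open>B\<close> is constant.
\<close>

lemma tangent_space_constrained_set:
  assumes "v \<in> tangent_space (constrained_set M B c) x"
  shows "v \<in> tangent_space M x" and "B v = 0"
proof -
  obtain \<gamma> :: "real \<Rightarrow> 'a" and \<epsilon> where \<epsilon>: "\<epsilon> > 0"
    and in_set: "\<gamma> ` {-\<epsilon><..<\<epsilon>} \<subseteq> constrained_set M B c"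
    and \<gamma>: "\<gamma> C1_differentiable_on {-\<epsilon><..<\<epsilon>}" "\<gamma> 0 = x" "(\<gamma> has_vector_derivative v) (at 0)"
    using assms unfolding tangent_space_def by auto
  have "\<gamma> ` {-\<epsilon><..<\<epsilon>} \<subseteq> M" using in_set unfolding constrained_set_def by auto
  then show "v \<in> tangent_space M x" unfolding tangent_space_def using \<epsilon> \<gamma> by blast
  have "((\<lambda>t. B (\<gamma> t)) has_vector_derivative B v) (at 0)"
    by (rule bounded_linear.has_vector_derivative[OF blinfun.bounded_linear_right \<gamma>(3)])
  moreover have "((\<lambda>t. B (\<gamma> t)) has_vector_derivative 0) (at 0)"
    by (rule has_vector_derivative_transform_within_open[where f = "\<lambda>_. c" and S = "{-\<epsilon><..<\<epsilon>}",
          OF has_vector_derivative_const])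
      (use \<epsilon> in_set in \<open>auto simp: constrained_set_def image_subset_iff\<close>)
  ultimately show "B v = 0" by (rule vector_derivative_unique_at)
qed

text \<open>
  The abstract setting applies with \<open>E = L\<^sup>-\<^sup>1 B\<close> and \<open>A = P\<^sub>x B\<^sup>*\<close>, whose norms are at most
  \<open>K_L \<parallel>B\<parallel>\<close> and \<open>K_P \<parallel>B\<parallel>\<close>. As \<open>L\<^sup>-\<^sup>1\<close> is injective, \<open>E (y - x) = 0\<close> says precisely that \<open>y\<close> satisfies
  the constraint, so the correction is the one that defines the constrained retraction.
\<close>

lemma retraction_curve_twice_differentiable:
  fixes B :: "'e::{real_inner, banach} \<Rightarrow>\<^sub>L 'y::{real_inner, banach}"
  assumes R: "has_C2_derivs_on (R x) DRx D2Rx T" "R x 0 = x" "\<And>h. h \<in> T \<Longrightarrow> DRx 0 h = h"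
    and x: "B x = c"
    and P: "is_projection_onto (P x) T" "norm (P x) \<le> K_P" "K_P > 0"
    and coercive: "C > 0" "\<And>\<delta>. L_op B P x \<delta> \<bullet> \<delta> \<ge> C * (norm \<delta>)\<^sup>2"
    and K_L: "onorm (inv (L_op B P x)) \<le> K_L" "K_L > 0"
    and B: "B \<noteq> 0"
    and bounds: "\<sigma> > 0" "K1 > 0" "K2 > 0"
      "\<And>u h. \<lbrakk>u \<in> T; norm u \<le> \<sigma>; h \<in> T\<rbrakk> \<Longrightarrow> norm (DRx u h) \<le> K1 * norm h"
      "\<And>u h k. \<lbrakk>u \<in> T; norm u \<le> \<sigma>; h \<in> T; k \<in> T\<rbrakk>
        \<Longrightarrow> norm (D2Rx u h k) \<le> K2 * norm h * norm k"
    and r: "r = min (\<sigma> / (2 * K_P * norm B)) (1 / (4 * K2 * K_L * K_P\<^sup>2 * norm B ^ 3))"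
    and \<Delta>s: "\<Delta>s = min (\<sigma> / 2) (min (1 / (4 * K2 * K_L * K_P * (norm B)\<^sup>2)) (r / (2 * K1 * K_L * norm B)))"
    and v: "v \<in> T" "norm v = 1" "B v = 0"
  shows "\<exists>c1 c2. (\<forall>t. \<bar>t\<bar> < \<Delta>s \<longrightarrow>
        ((\<lambda>t. retr_B B c P R r x (t *\<^sub>R v)) has_vector_derivative c1 t) (at t) \<and>
        (c1 has_vector_derivative c2 t) (at t)) \<and>
      c1 0 = v"
    and "retr_B B c P R r x 0 = x"
proof -
  let ?L = "L_op B P x" and ?Bt = "adjoint (blinfun_apply B)"
  have L: "bounded_linear ?L"
    unfolding L_op_def[abs_def]
    by (intro bounded_linear_compose[OF blinfun.bounded_linear_right] bounded_linear_adjoint)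
  note bij = lax_milgram(1)[OF L coercive] and inv_L = lax_milgram(2)[OF L coercive]
  define Bt where "Bt = Blinfun ?Bt"
  define Li where "Li = Blinfun (inv ?L)"
  have Bt: "Bt y = ?Bt y" for y
    by (simp add: Bt_def bounded_linear_Blinfun_apply bounded_linear_adjoint)
  have Li: "Li y = inv ?L y" for y
    by (simp add: Li_def bounded_linear_Blinfun_apply inv_L)
  define E where "E = Li o\<^sub>L B"
  define A where "A = P x o\<^sub>L Bt"
  have range_P: "T = range (P x)"
    using P(1) by (auto simp: is_projection_onto_def)
  have b: "norm B > 0" using B by simp
  have r_pos: "r > 0" using bounds P(3) K_L(2) b unfolding r by simp
  have \<Delta>_pos: "\<Delta>s > 0" using bounds P(3) K_L(2) b r_pos unfolding \<Delta>s by simp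
  have Li_inj: "Li y = 0 \<longleftrightarrow> y = 0" for y
    using bij unfolding Li by (metis bij_inv_eq_iff linear_simps(3)[OF L])
  interpret tangential_correction T "R x" DRx D2Rx E A v "K_L * norm B" "K_P * norm B" K1 K2 \<sigma> r \<Delta>s
  proof
    show "subspace T" unfolding range_P
      by (intro linear_subspace_image subspace_UNIV bounded_linear.linear blinfun.bounded_linear_right)
    show "(R x has_derivative DRx u) (at u within T)" if "u \<in> T" for u
      using R(1) that by (auto simp: has_C2_derivs_on_def)
    show "(DRx has_derivative D2Rx u) (at u within T)" if "u \<in> T" for u
      using R(1) that by (auto simp: has_C2_derivs_on_def)
    show "A y \<in> T" for y by (simp add: A_def range_P)
    show "E (A y) = y" for y
    proof -
      have "E (A y) = inv ?L (?L y)" by (simp add: E_def A_def Li Bt L_op_def)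
      then show ?thesis using bij by (simp add: bij_is_inj)
    qed
    show "E v = 0" using v by (simp add: E_def)
    have "norm Li \<le> K_L"
      using K_L(1) by (simp add: Li_def norm_blinfun.rep_eq bounded_linear_Blinfun_apply inv_L)
    then show "norm E \<le> K_L * norm B"
      unfolding E_def by (rule order_trans[OF norm_blinfun_compose mult_right_mono]) simp
    have "norm Bt \<le> norm B"
      by (rule norm_blinfun_bound) (auto simp: Bt bounded_linear_adjoint)
    then show "norm A \<le> K_P * norm B"
      unfolding A_def using P by (intro order_trans[OF norm_blinfun_compose mult_mono]) auto
    \<comment> \<open>the first terms of \<open>r\<close> and \<open>\<Delta>s\<close> share the radius \<open>\<sigma>\<close> between correction and step, the second
      terms share the contraction constant, and the last term of \<open>\<Delta>s\<close> bounds the initial violation\<close>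
    have r1: "r \<le> \<sigma> / (2 * K_P * norm B)" and r2: "r \<le> 1 / (4 * K2 * K_L * K_P\<^sup>2 * norm B ^ 3)"
      unfolding r by auto
    have D1: "\<Delta>s \<le> \<sigma> / 2" and D2: "\<Delta>s \<le> 1 / (4 * K2 * K_L * K_P * (norm B)\<^sup>2)"
      and D3: "\<Delta>s \<le> r / (2 * K1 * K_L * norm B)"
      unfolding \<Delta>s by auto
    have "K_P * norm B * r \<le> \<sigma> / 2" using r1 P(3) b by (simp add: field_simps)
    then show "\<Delta>s + K_P * norm B * r \<le> \<sigma>" using D1 by simp
    have "(4 * K2 * K_L * K_P\<^sup>2 * norm B ^ 3) * r \<le> 1"
      using r2 P(3) K_L(2) bounds b by (subst (asm) pos_le_divide_eq) (auto simp: mult.commute)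
    moreover have "(4 * K2 * K_L * K_P * (norm B)\<^sup>2) * \<Delta>s \<le> 1"
      using D2 P(3) K_L(2) bounds b by (subst (asm) pos_le_divide_eq) (auto simp: mult.commute)
    ultimately show "K_L * norm B * (K_P * norm B) * K2 * (\<Delta>s + K_P * norm B * r) \<le> 1 / 2"
      by (simp add: power2_eq_square power3_eq_cube algebra_simps)
    show "K_L * norm B * K1 * \<Delta>s \<le> r / 2"
      using D3 K_L(2) bounds b by (simp add: field_simps)
  qed (use R(3) bounds v b r_pos \<Delta>_pos K_L(2) P(3) in auto)
  have E_zero: "E (y - x) = 0 \<longleftrightarrow> B y = c" for y
  proof -
    have "E (y - x) = 0 \<longleftrightarrow> B (y - x) = 0" by (simp add: E_def Li_inj )
    then show ?thesis by (simp add: blinfun.diff_right x)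
  qed
  have delta: "delta_map B c P R r x (t *\<^sub>R v) = correction t" for t
    unfolding delta_map_def correction_def by (simp add: R(2) E_zero A_def Bt)
  have curve: "retr_B B c P R r x (t *\<^sub>R v) = R x (corrected t)" for t
    unfolding retr_B_def delta corrected_def by (simp add: A_def Bt)
  show "retr_B B c P R r x 0 = x"
    using curve[of 0] by (simp add: corrected_def correction_0 R(2))
  show "\<exists>c1 c2. (\<forall>t. \<bar>t\<bar> < \<Delta>s \<longrightarrow>
        ((\<lambda>t. retr_B B c P R r x (t *\<^sub>R v)) has_vector_derivative c1 t) (at t) \<and>
        (c1 has_vector_derivative c2 t) (at t)) \<and>
      c1 0 = v"
    unfolding curve using corrected_curve_twice_differentiable by metis
qed


section \<open>Objectives along curves of bounded acceleration\<close>

text \<open>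
  The bound on the acceleration confines the velocity to \<open>1 + \<beta> D\<close> and the curve to the ball of
  radius \<open>q + (1 + \<beta> D) D\<close>. The constant on the right depends on the curve only through these bounds,
  so it serves a whole family of curves at once.
\<close>

lemma radial_objective_Lipschitz:
  fixes J :: "'e::{real_inner, banach} \<Rightarrow> real" and \<kappa> :: "real \<Rightarrow> 'e"
  assumes \<kappa>: "\<And>t. t \<in> {0..D} \<Longrightarrow> (\<kappa> has_vector_derivative \<kappa>1 t) (at t)"
    and \<kappa>1: "\<And>t. t \<in> {0..D} \<Longrightarrow> (\<kappa>1 has_vector_derivative \<kappa>2 t) (at t)"
    and \<beta>: "\<And>t. t \<in> {0..D} \<Longrightarrow> norm (\<kappa>2 t) \<le> \<beta>"
    and start: "norm (\<kappa> 0) \<le> q" "norm (\<kappa>1 0) = 1"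
    and J: "\<And>y. GDERIV J y :> gradJ y" "\<And>y. (gradJ has_derivative blinfun_apply (HessJ y)) (at y)"
    and G: "\<And>y. norm y \<le> q + (1 + \<beta> * D) * D \<Longrightarrow> norm (gradJ y) \<le> G"
    and H: "\<And>y. norm y \<le> q + (1 + \<beta> * D) * D \<Longrightarrow> norm (HessJ y) \<le> H"
    and t: "t \<in> {0..D}"
  shows "(\<lambda>s. J (\<kappa> s)) differentiable (at t)"
    and "\<bar>deriv (\<lambda>s. J (\<kappa> s)) t - deriv (\<lambda>s. J (\<kappa> s)) 0\<bar> \<le> (H * (1 + \<beta> * D)\<^sup>2 + G * \<beta>) * t"
proof -
  have mvt: "norm (f s - f 0) \<le> b * s"
    if s: "s \<in> {0..D}" and f: "\<And>t. t \<in> {0..D} \<Longrightarrow> (f has_vector_derivative f' t) (at t)"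
      and b: "\<And>t. t \<in> {0..D} \<Longrightarrow> norm (f' t) \<le> b"
    for f :: "real \<Rightarrow> 'b::real_normed_vector" and f' s b
  proof -
    have "norm (f s - f 0) \<le> b * norm (s - 0)"
    proof (rule differentiable_bound[where S = "{0..D}" and f' = "\<lambda>t h. h *\<^sub>R f' t"])
      fix t assume t: "t \<in> {0..D}"
      then show "(f has_derivative (\<lambda>h. h *\<^sub>R f' t)) (at t within {0..D})"
        using f unfolding has_vector_derivative_def by (blast intro: has_derivative_at_withinI)
      show "onorm (\<lambda>h. h *\<^sub>R f' t) \<le> b"
        using b[OF t] by (intro onorm_le) (simp add: mult.commute[of b] mult_left_mono)
    qed (use s in auto)
    then show ?thesis using s by simp
  qed
  have D: "0 \<le> D" using t by simp
  have \<beta>0: "0 \<le> \<beta>" using \<beta>[OF t] norm_ge_zero order_trans by blast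
  have vel: "norm (\<kappa>1 s) \<le> 1 + \<beta> * D" if s: "s \<in> {0..D}" for s
  proof -
    have "norm (\<kappa>1 s - \<kappa>1 0) \<le> \<beta> * s" by (rule mvt[OF s \<kappa>1 \<beta>])
    also have "\<dots> \<le> \<beta> * D" using s \<beta>0 by (simp add: mult_left_mono)
    finally show ?thesis using norm_triangle_sub[of "\<kappa>1 s" "\<kappa>1 0"] start(2) by simp
  qed
  have pos: "norm (\<kappa> s) \<le> q + (1 + \<beta> * D) * D" if s: "s \<in> {0..D}" for s
  proof -
    have "norm (\<kappa> s - \<kappa> 0) \<le> (1 + \<beta> * D) * s" by (rule mvt[OF s \<kappa> vel])
    also have "\<dots> \<le> (1 + \<beta> * D) * D" using s \<beta>0 D by (intro mult_left_mono) auto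
    finally show ?thesis using norm_triangle_sub[of "\<kappa> s" "\<kappa> 0"] start(1) by simp
  qed
  define \<phi> where "\<phi> s = \<kappa>1 s \<bullet> gradJ (\<kappa> s)" for s
  have deriv_\<phi>: "((\<lambda>s. J (\<kappa> s)) has_field_derivative \<phi> s) (at s)" if s: "s \<in> {0..D}" for s
  proof -
    have "((\<lambda>s. J (\<kappa> s)) has_derivative (\<lambda>h. (h *\<^sub>R \<kappa>1 s) \<bullet> gradJ (\<kappa> s))) (at s)"
      using \<kappa>[OF s] J(1)[of "\<kappa> s"] unfolding has_vector_derivative_def gderiv_def
      by (rule has_derivative_compose)
    then show ?thesis
      by (simp add: has_field_derivative_def \<phi>_def mult.commute[of _ "\<kappa>1 s \<bullet> gradJ (\<kappa> s)"] mult_commute_abs)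
  qed
  have deriv2: "(\<phi> has_vector_derivative \<kappa>1 s \<bullet> HessJ (\<kappa> s) (\<kappa>1 s) + \<kappa>2 s \<bullet> gradJ (\<kappa> s)) (at s)"
    if s: "s \<in> {0..D}" for s
  proof -
    have "((\<lambda>s. gradJ (\<kappa> s)) has_derivative (\<lambda>h. HessJ (\<kappa> s) (h *\<^sub>R \<kappa>1 s))) (at s)"
      using \<kappa>[OF s] J(2)[of "\<kappa> s"] unfolding has_vector_derivative_def
      by (rule has_derivative_compose)
    then have "((\<lambda>s. gradJ (\<kappa> s)) has_vector_derivative HessJ (\<kappa> s) (\<kappa>1 s)) (at s)"
      by (simp add: has_vector_derivative_def blinfun.scaleR_right)
    from bounded_bilinear.has_vector_derivative[OF bounded_bilinear_inner \<kappa>1[OF s] this]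
    show ?thesis unfolding \<phi>_def .
  qed
  have bound2: "norm (\<kappa>1 s \<bullet> HessJ (\<kappa> s) (\<kappa>1 s) + \<kappa>2 s \<bullet> gradJ (\<kappa> s)) \<le> H * (1 + \<beta> * D)\<^sup>2 + G * \<beta>"
    if s: "s \<in> {0..D}" for s
  proof -
    have "\<bar>\<kappa>1 s \<bullet> HessJ (\<kappa> s) (\<kappa>1 s)\<bar> \<le> norm (\<kappa>1 s) * (norm (HessJ (\<kappa> s)) * norm (\<kappa>1 s))"
      by (rule order_trans[OF Cauchy_Schwarz_ineq2 mult_left_mono[OF norm_blinfun]]) simp
    also have "\<dots> \<le> (1 + \<beta> * D) * (H * (1 + \<beta> * D))"
      using vel[OF s] H[OF pos[OF s]] \<beta>0 D
      by (intro mult_mono) (auto intro: order_trans[OF norm_ge_zero])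
    finally have "\<bar>\<kappa>1 s \<bullet> HessJ (\<kappa> s) (\<kappa>1 s)\<bar> \<le> H * (1 + \<beta> * D)\<^sup>2"
      by (simp add: power2_eq_square ac_simps)
    moreover have "\<bar>\<kappa>2 s \<bullet> gradJ (\<kappa> s)\<bar> \<le> \<beta> * G"
      using \<beta>[OF s] G[OF pos[OF s]] \<beta>0
      by (intro order_trans[OF Cauchy_Schwarz_ineq2 mult_mono]) auto
    ultimately show ?thesis by (simp add: mult.commute)
  qed
  have "norm (\<phi> t - \<phi> 0) \<le> (H * (1 + \<beta> * D)\<^sup>2 + G * \<beta>) * t"
    by (rule mvt[OF t deriv2 bound2])
  moreover have "deriv (\<lambda>s. J (\<kappa> s)) s = \<phi> s" if "s \<in> {0..D}" for s
    using deriv_\<phi>[OF that] by (rule DERIV_imp_deriv)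
  ultimately show "\<bar>deriv (\<lambda>s. J (\<kappa> s)) t - deriv (\<lambda>s. J (\<kappa> s)) 0\<bar> \<le> (H * (1 + \<beta> * D)\<^sup>2 + G * \<beta>) * t"
    using t D by simp
  show "(\<lambda>s. J (\<kappa> s)) differentiable (at t)"
    using deriv_\<phi>[OF t] real_differentiable_def by blast
qed

theorem theorem5p4:
  fixes M X :: "'e::{real_inner, banach} set"
    and B :: "'e \<Rightarrow>\<^sub>L 'y::{real_inner, banach}"
    and c :: 'y
    and P :: "'e \<Rightarrow> 'e \<Rightarrow>\<^sub>L 'e"
    and R :: "'e \<Rightarrow> 'e \<Rightarrow> 'e"
    and DR :: "'e \<Rightarrow> 'e \<Rightarrow> 'e \<Rightarrow>\<^sub>L 'e"
    and D2R :: "'e \<Rightarrow> 'e \<Rightarrow> 'e \<Rightarrow>\<^sub>L 'e \<Rightarrow>\<^sub>L 'e"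
    and J :: "'e \<Rightarrow> real"
    and gradJ :: "'e \<Rightarrow> 'e"
    and HessJ :: "'e \<Rightarrow> 'e \<Rightarrow>\<^sub>L 'e"
    and K_P K_L \<sigma> K1 K2 r \<Delta>s \<beta>D \<Delta>D :: real
  assumes Y_nontrivial: "\<exists>y::'y. y \<noteq> 0"
    and M_submanifold: "C2_submanifold M"
    and B_surj: "surj (blinfun_apply B)"
    and MB_nonempty: "constrained_set M B c \<noteq> {}"
    and P_proj: "\<forall>x\<in>M. is_projection_onto (P x) (tangent_space M x)"
    and R_retr: "C2_retraction M R DR D2R"
    and A1: "\<forall>S. S \<subseteq> constrained_set M B c \<and> bounded S \<longrightarrow>
               (\<exists>C>0. \<forall>x\<in>S. \<forall>\<delta>. L_op B P x \<delta> \<bullet> \<delta> \<ge> C * (norm \<delta>)\<^sup>2)"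
    and A2_cont: "continuous_on M P"
    and A2_bounded: "\<forall>S. S \<subseteq> M \<and> bounded S \<longrightarrow> bounded (P ` S)"
    and A3: "\<forall>S. S \<subseteq> M \<and> bounded S \<longrightarrow> (\<exists>\<sigma> K1 K2. retraction_bounds M DR D2R S \<sigma> K1 K2)"
    and J_grad: "\<forall>x. GDERIV J x :> gradJ x"
    and J_Hess: "\<forall>x. (gradJ has_derivative blinfun_apply (HessJ x)) (at x)"
    and J_C2: "continuous_on UNIV HessJ"
    and J_bounded_below: "bdd_below (range J)"
    and J_coercive: "filterlim J at_top at_infinity"
    and grad_bounded: "\<forall>S. bounded S \<longrightarrow> bounded (gradJ ` S)"
    and Hess_bounded: "\<forall>S. bounded S \<longrightarrow> bounded (HessJ ` S)"
    and X_sub: "X \<subseteq> constrained_set M B c"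
    and X_bounded: "bounded X"
    and K_P: "K_P > 0" "\<forall>x\<in>X. norm (P x) \<le> K_P"
    and K_L: "K_L > 0" "\<forall>x\<in>X. onorm (inv (L_op B P x)) \<le> K_L"
    and R_bounds: "retraction_bounds M DR D2R X \<sigma> K1 K2"
    and r: "r = min (\<sigma> / (2 * K_P * norm B)) (1 / (4 * K2 * K_L * K_P\<^sup>2 * norm B ^ 3))"
    and \<Delta>s: "\<Delta>s = min (\<sigma> / 2) (min (1 / (4 * K2 * K_L * K_P * (norm B)\<^sup>2)) (r / (2 * K1 * K_L * norm B)))"
    and \<beta>D: "\<beta>D > 0"
    and \<Delta>D: "0 < \<Delta>D" "\<Delta>D < \<Delta>s"
    and second_deriv: "\<forall>x\<in>X. \<forall>v\<in>tangent_space (constrained_set M B c) x. norm v = 1 \<longrightarrow>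
           (\<forall>t\<in>{0..\<Delta>D}.
              norm (vector_derivative
                      (\<lambda>s. vector_derivative (\<lambda>\<tau>. retr_B B c P R r x (\<tau> *\<^sub>R v)) (at s)) (at t)) \<le> \<beta>D)"
  shows "\<exists>\<beta>RL>0. radially_Lipschitz_C1 X (tangent_space (constrained_set M B c))
                    (lifted_objective J B c P R r) \<Delta>D \<beta>RL"
proof -
  have B: "B \<noteq> 0"
  proof
    assume "B = 0"
    then have "(y :: 'y) = 0" for y using B_surj by (auto simp: surj_def)
    then show False using Y_nontrivial by blast
  qed
  obtain C where C: "C > 0" "\<And>x \<delta>. x \<in> X \<Longrightarrow> L_op B P x \<delta> \<bullet> \<delta> \<ge> C * (norm \<delta>)\<^sup>2"
    using A1 X_sub X_bounded by meson
  obtain q where q: "\<And>x. x \<in> X \<Longrightarrow> norm x \<le> q" using X_bounded by (auto simp: bounded_iff)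
  \<comment> \<open>one ball that contains the curves of all points of \<open>X\<close> and all directions\<close>
  define \<Omega> :: "'e set" where "\<Omega> = cball 0 (q + (1 + \<beta>D * \<Delta>D) * \<Delta>D)"
  have "bounded \<Omega>" by (simp add: \<Omega>_def)
  then have "bounded (gradJ ` \<Omega>)" "bounded (HessJ ` \<Omega>)" using grad_bounded Hess_bounded by auto
  then obtain G H where G: "G > 0" "\<And>y. y \<in> \<Omega> \<Longrightarrow> norm (gradJ y) \<le> G"
    and H: "H > 0" "\<And>y. y \<in> \<Omega> \<Longrightarrow> norm (HessJ y) \<le> H"
    unfolding bounded_pos by auto
  let ?\<beta> = "H * (1 + \<beta>D * \<Delta>D)\<^sup>2 + G * \<beta>D"
  have "?\<beta> > 0" using G(1) H(1) \<beta>D by (intro add_nonneg_pos) auto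
  moreover have "radially_Lipschitz_C1 X (tangent_space (constrained_set M B c))
      (lifted_objective J B c P R r) \<Delta>D ?\<beta>"
    unfolding radially_Lipschitz_C1_def
  proof (intro ballI impI)
    fix x v t
    assume x: "x \<in> X" and v: "v \<in> tangent_space (constrained_set M B c) x" "norm v = 1"
      and t: "t \<in> {0..\<Delta>D}"
    have xM: "x \<in> M" "B x = c" using x X_sub by (auto simp: constrained_set_def)
    let ?\<kappa> = "\<lambda>t. retr_B B c P R r x (t *\<^sub>R v)"
    have R: "has_C2_derivs_on (R x) (DR x) (D2R x) (tangent_space M x)" "R x 0 = x"
      "\<And>h. h \<in> tangent_space M x \<Longrightarrow> DR x 0 h = h"
      using R_retr xM by (auto simp: C2_retraction_def)
    have bounds: "\<sigma> > 0" "K1 > 0" "K2 > 0"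
      using R_bounds by (auto simp: retraction_bounds_def)
    have D1: "norm (DR x u h) \<le> K1 * norm h"
      if "u \<in> tangent_space M x" "norm u \<le> \<sigma>" "h \<in> tangent_space M x" for u h
      using R_bounds x that by (auto simp: retraction_bounds_def)
    have D2: "norm (D2R x u h k) \<le> K2 * norm h * norm k"
      if "u \<in> tangent_space M x" "norm u \<le> \<sigma>" "h \<in> tangent_space M x" "k \<in> tangent_space M x"
      for u h k
      using R_bounds x that by (auto simp: retraction_bounds_def)
    note tangent = tangent_space_constrained_set[OF v(1)]
    note curve = retraction_curve_twice_differentiable[where R = R and P = P and x = x, OF R
        xM(2) P_proj[rule_format, OF xM(1)] K_P(2)[rule_format, OF x] K_P(1) C(1) C(2)[OF x]
        K_L(2)[rule_format, OF x] K_L(1) B bounds D1 D2 r \<Delta>s tangent(1) v(2) tangent(2)]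
    have curve_regular: "\<exists>\<kappa>1 \<kappa>2. (\<forall>t. \<bar>t\<bar> < \<Delta>s \<longrightarrow>
        (?\<kappa> has_vector_derivative \<kappa>1 t) (at t) \<and>
        (\<kappa>1 has_vector_derivative \<kappa>2 t) (at t)) \<and>
      \<kappa>1 0 = v"
      by (rule curve(1))
    have curve_0: "retr_B B c P R r x 0 = x"
      by (rule curve(2))
    obtain \<kappa>1 \<kappa>2 where curve_derivatives: "(\<forall>t. \<bar>t\<bar> < \<Delta>s \<longrightarrow>
        (?\<kappa> has_vector_derivative \<kappa>1 t) (at t) \<and>
        (\<kappa>1 has_vector_derivative \<kappa>2 t) (at t)) \<and>
      \<kappa>1 0 = v"
      using curve_regular by (elim exE)
    have \<kappa>: "(?\<kappa> has_vector_derivative \<kappa>1 t) (at t)" if "\<bar>t\<bar> < \<Delta>s" for t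
      using curve_derivatives that by simp
    have \<kappa>1: "(\<kappa>1 has_vector_derivative \<kappa>2 t) (at t)" if "\<bar>t\<bar> < \<Delta>s" for t
      using curve_derivatives that by simp
    have start: "\<kappa>1 0 = v" "retr_B B c P R r x 0 = x"
      using curve_derivatives curve_0 by auto
    \<comment> \<open>for \<open>s\<close> at an end of \<open>[0, \<Delta>D]\<close> too, the iterated derivative in the hypothesis is that of
      \<open>\<kappa>1\<close>, since \<open>\<kappa>1\<close> is the velocity on the larger open interval\<close>
    have second: "norm (\<kappa>2 s) \<le> \<beta>D" if s: "s \<in> {0..\<Delta>D}" for s
    proof -
      have "((\<lambda>s. vector_derivative ?\<kappa> (at s)) has_vector_derivative \<kappa>2 s) (at s)"
        by (rule has_vector_derivative_transform_within_open[OF \<kappa>1, of _ "{-\<Delta>s<..<\<Delta>s}"])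
          (use s \<Delta>D in \<open>auto simp: vector_derivative_at[OF \<kappa>]\<close>)
      then show ?thesis using second_deriv x v s by (metis vector_derivative_at)
    qed
    have "(\<lambda>s. J (?\<kappa> s)) differentiable (at t) \<and>
        \<bar>deriv (\<lambda>s. J (?\<kappa> s)) t - deriv (\<lambda>s. J (?\<kappa> s)) 0\<bar> \<le> ?\<beta> * t"
      using radial_objective_Lipschitz[of \<Delta>D ?\<kappa> \<kappa>1 \<kappa>2 \<beta>D q J gradJ HessJ G H t]
        \<kappa> \<kappa>1 second start q[OF x] v(2) J_grad J_Hess G(2) H(2) t \<Delta>D
      by (simp add: \<Omega>_def)
    then show "(\<lambda>s. lifted_objective J B c P R r x (s *\<^sub>R v)) differentiable (at t) \<and>
        \<bar>deriv (\<lambda>s. lifted_objective J B c P R r x (s *\<^sub>R v)) t -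
          deriv (\<lambda>s. lifted_objective J B c P R r x (s *\<^sub>R v)) 0\<bar> \<le> ?\<beta> * t"
      unfolding lifted_objective_def .
  qed
  ultimately show ?thesis by blast
qed

end
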